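(* Let $S,T$ be linear operators acting on a Hilbert space $\mathscr{H}$. Assume that (a) $S$ is selfadjoint with $\operatorname{dom} S\subseteq\operatorname{dom} T$; (b) there is some $0\leq q<1$ such that $\|Th\|^2\leq q\|Sh\|^2+\|h\|^2$ for all $h\in\operatorname{dom} S$; (c) $(Th\,|\,k)=(h\,|\,Tk)$ for all $h,k\in\operatorname{dom} S$. Then $S+T$ is selfadjoint.
   Context: The Hilbert space may be real or complex. A linear operator is a possibly unbounded, not necessarily densely defined linear map defined on a linear subspace $\operatorname{dom}$. The scalar product is denoted $(\cdot\,|\,\cdot)$. The sum $S+T$ is defined on $\operatorname{dom}S\cap\operatorname{dom}T=\operatorname{dom}S$. A densely defined operator $S$ is selfadjoint if $S=S^*$ (equality including domains). *)

theory Defs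
  imports "HOL-Analysis.Analysis"
begin

text \<open>
  The scalar field is the real or the complex numbers.  The embedding \<open>scalar_to_complex\<close> is
  an isometric homomorphism of real algebras, so its range is a real subspace of the complex
  plane containing the real line; see \<open>range_scalar_to_complex\<close> below.
\<close>

class real_or_complex = real_normed_field +
  fixes scalar_to_complex :: "'a \<Rightarrow> complex"
    and scalar_cnj :: "'a \<Rightarrow> 'a"
  assumes scalar_to_complex_add:
      "scalar_to_complex (x + y) = scalar_to_complex x + scalar_to_complex y"
    and scalar_to_complex_mult:
      "scalar_to_complex (x * y) = scalar_to_complex x * scalar_to_complex y"
    and scalar_to_complex_scaleR:
      "scalar_to_complex (r *\<^sub>R x) = r *\<^sub>R scalar_to_complex x"
    and norm_scalar_to_complex: "norm (scalar_to_complex x) = norm x"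
    and scalar_to_complex_cnj: "scalar_to_complex (scalar_cnj x) = cnj (scalar_to_complex x)"

instantiation real :: real_or_complex
begin

definition "scalar_to_complex (x :: real) = complex_of_real x"
definition "scalar_cnj (x :: real) = x"

instance
  by standard (simp_all add: scalar_to_complex_real_def scalar_cnj_real_def scaleR_conv_of_real)

end

instantiation complex :: real_or_complex
begin

definition "scalar_to_complex (x :: complex) = x"
definition "scalar_cnj (x :: complex) = cnj x"

instance
  by standard (simp_all add: scalar_to_complex_complex_def scalar_cnj_complex_def)

end

lemma scalar_to_complex_1: "scalar_to_complex (1 :: 'k :: real_or_complex) = 1"
proof -
  let ?e = "scalar_to_complex (1 :: 'k)"
  have "?e * ?e = ?e"
    using scalar_to_complex_mult[of "1 :: 'k" 1] by simp
  moreover have "?e \<noteq> 0"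
    using norm_scalar_to_complex[of "1 :: 'k"] by auto
  ultimately show ?thesis by simp
qed

lemma scalar_to_complex_of_real:
  "scalar_to_complex (of_real r :: 'k :: real_or_complex) = of_real r"
  by (simp add: of_real_def scalar_to_complex_scaleR scalar_to_complex_1)

lemma inj_scalar_to_complex: "inj (scalar_to_complex :: 'k :: real_or_complex \<Rightarrow> complex)"
proof (rule injI)
  fix x y :: 'k
  assume eq: "scalar_to_complex x = scalar_to_complex y"
  have "scalar_to_complex x = scalar_to_complex (x - y) + scalar_to_complex y"
    using scalar_to_complex_add[of "x - y" y] by simp
  then have "norm (x - y) = 0"
    using eq norm_scalar_to_complex[of "x - y"] by simp
  then show "x = y" by simp
qed

lemma range_scalar_to_complex:
  "range (scalar_to_complex :: 'k :: real_or_complex \<Rightarrow> complex) = \<real> \<or>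
   range (scalar_to_complex :: 'k \<Rightarrow> complex) = UNIV"
proof (cases "range (scalar_to_complex :: 'k \<Rightarrow> complex) \<subseteq> \<real>")
  case True
  have "of_real r \<in> range (scalar_to_complex :: 'k \<Rightarrow> complex)" for r
    by (metis rangeI scalar_to_complex_of_real)
  then have "range (scalar_to_complex :: 'k \<Rightarrow> complex) = \<real>"
    using True by (auto simp: Reals_def)
  then show ?thesis ..
next
  case False
  then obtain x :: 'k where x: "Im (scalar_to_complex x) \<noteq> 0"
    unfolding complex_is_Real_iff by (metis complex_is_Real_iff imageE subsetI)
  have "z \<in> range (scalar_to_complex :: 'k \<Rightarrow> complex)" for z
  proof -
    define b where "b = Im z / Im (scalar_to_complex x)"
    define a where "a = Re z - b * Re (scalar_to_complex x)"
    have "scalar_to_complex (of_real a + b *\<^sub>R x) = z"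
      unfolding scalar_to_complex_add scalar_to_complex_of_real scalar_to_complex_scaleR
      using x by (simp add: a_def b_def complex_eq_iff)
    then show ?thesis by (metis rangeI)
  qed
  then show ?thesis by auto
qed

text \<open>
  The norm, the topology and completeness are those of the Banach space type \<open>'v\<close>; the norm is
  tied to the scalar product, which is linear in its first argument.  Positive definiteness is
  contained in \<open>ip_self\<close>.
\<close>

locale hilbert_space = vector_space scaleK
  for scaleK :: "'k :: real_or_complex \<Rightarrow> 'v :: banach \<Rightarrow> 'v" +
  fixes ip :: "'v \<Rightarrow> 'v \<Rightarrow> 'k"
  assumes scale_of_real: "scaleK (of_real r) x = r *\<^sub>R x"
    and ip_add_left: "ip (x + y) z = ip x z + ip y z"
    and ip_scale_left: "ip (scaleK c x) y = c * ip x y"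
    and ip_commute: "ip x y = scalar_cnj (ip y x)"
    and ip_self: "ip x x = of_real ((norm x)\<^sup>2)"

lemma hilbert_space_real:
  "hilbert_space (scaleR :: real \<Rightarrow> 'v \<Rightarrow> 'v :: {real_inner, banach}) inner"
  by unfold_locales
    (simp_all add: scalar_cnj_real_def algebra_simps inner_commute power2_norm_eq_inner)

lemma hilbert_space_complex: "hilbert_space (*) (\<lambda>z w :: complex. z * cnj w)"
  by unfold_locales
    (simp_all add: scalar_cnj_complex_def algebra_simps scaleR_conv_of_real complex_norm_square
      del: of_real_power)

text \<open>
  A possibly unbounded operator is a partial function, with \<open>None\<close> off its domain, so that
  equality of operators includes equality of domains.
\<close>

type_synonym 'v operator = "'v \<rightharpoonup> 'v"

definition app :: "'v operator \<Rightarrow> 'v \<Rightarrow> 'v" where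
  "app S h = the (S h)"

definition linear_operator ::
    "('k :: field \<Rightarrow> 'v :: ab_group_add \<Rightarrow> 'v) \<Rightarrow> 'v operator \<Rightarrow> bool" where
  "linear_operator scaleK S \<longleftrightarrow>
     module.subspace scaleK (dom S) \<and>
     (\<forall>h\<in>dom S. \<forall>k\<in>dom S. app S (h + k) = app S h + app S k) \<and>
     (\<forall>c. \<forall>h\<in>dom S. app S (scaleK c h) = scaleK c (app S h))"

definition operator_sum ::
    "'v :: ab_group_add operator \<Rightarrow> 'v operator \<Rightarrow> 'v operator" where
  "operator_sum S T h =
     (if h \<in> dom S \<inter> dom T then Some (app S h + app T h) else None)"

definition densely_defined :: "'v :: topological_space operator \<Rightarrow> bool" where
  "densely_defined S \<longleftrightarrow> closure (dom S) = UNIV"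

text \<open>
  Meaningful only for densely defined \<open>S\<close>, where \<open>z\<close> is unique; see
  \<open>adjoint_eq_Some_iff\<close> below.
\<close>

definition adjoint_operator ::
    "('v \<Rightarrow> 'v \<Rightarrow> 'k) \<Rightarrow> 'v operator \<Rightarrow> 'v operator" where
  "adjoint_operator ip S k =
     (if \<exists>z. \<forall>h\<in>dom S. ip (app S h) k = ip h z
      then Some (THE z. \<forall>h\<in>dom S. ip (app S h) k = ip h z)
      else None)"

definition selfadjoint ::
    "('v :: topological_space \<Rightarrow> 'v \<Rightarrow> 'k) \<Rightarrow> 'v operator \<Rightarrow> bool" where
  "selfadjoint ip S \<longleftrightarrow> densely_defined S \<and> adjoint_operator ip S = S"

context hilbert_space
begin

lemma scalar_cnj_add: "scalar_cnj (a + b) = scalar_cnj a + scalar_cnj (b :: 'k)"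
  by (rule injD[OF inj_scalar_to_complex])
    (simp add: scalar_to_complex_add scalar_to_complex_cnj)

lemma ip_add_right: "ip x (y + z) = ip x y + ip x z"
  by (metis ip_commute ip_add_left scalar_cnj_add)

lemma orthogonal_dense_eq_0:
  assumes "closure D = UNIV" and D: "\<And>h. h \<in> D \<Longrightarrow> ip h w = 0"
  shows "w = 0"
proof (rule ccontr)
  assume "w \<noteq> 0"
  then have "norm w > 0" by simp
  then obtain h where h: "h \<in> D" "dist h w < norm w"
    using assms(1) closure_approachable[of w D] by blast
  have w_h: "ip w h = 0"
    using D[OF h(1)] ip_commute[of w h] scalar_cnj_add[of 0 0] by simp
  have e: "ip (h - w) x = ip h x - ip w x" for x
    using ip_add_left[of "h - w" w x] by simp
  have "ip (h - w) (h - w) + ip (h - w) w = ip (h - w) h"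
    using ip_add_right[of "h - w" "h - w" w] by simp
  then have "ip (h - w) (h - w) = ip h h + ip w w"
    using D[OF h(1)] w_h by (simp add: e diff_eq_eq)
  then have "of_real ((norm (h - w))\<^sup>2) = (of_real ((norm h)\<^sup>2 + (norm w)\<^sup>2) :: 'k)"
    by (simp add: ip_self)
  then have "(norm (h - w))\<^sup>2 = (norm h)\<^sup>2 + (norm w)\<^sup>2"
    by (simp only: of_real_eq_iff)
  then have "(norm w)\<^sup>2 \<le> (norm (h - w))\<^sup>2" by simp
  then have "norm w \<le> norm (h - w)" by (simp add: power2_le_iff_abs_le)
  then show False using h(2) by (simp add: dist_norm)
qed

lemma adjoint_eq_Some_iff:
  assumes "densely_defined S"
  shows "adjoint_operator ip S k = Some z \<longleftrightarrow> (\<forall>h\<in>dom S. ip (app S h) k = ip h z)"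
proof -
  have uniq: "z = z'"
    if "\<forall>h\<in>dom S. ip (app S h) k = ip h z" "\<forall>h\<in>dom S. ip (app S h) k = ip h z'" for z z'
  proof -
    have "ip h (z - z') = 0" if "h \<in> dom S" for h
      using ip_add_right[of h "z - z'" z'] that
        \<open>\<forall>h\<in>dom S. ip (app S h) k = ip h z\<close> \<open>\<forall>h\<in>dom S. ip (app S h) k = ip h z'\<close>
      by simp
    then show ?thesis
      using assms orthogonal_dense_eq_0[of "dom S" "z - z'"] by (simp add: densely_defined_def)
  qed
  let ?P = "\<lambda>z. \<forall>h\<in>dom S. ip (app S h) k = ip h z"
  have the: "(THE z. ?P z) = z" if "?P z" for z
    using that uniq by (intro the_equality) auto
  show ?thesis
  proof (cases "\<exists>z. ?P z")
    case True
    then obtain z0 where "?P z0" by blast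
    then show ?thesis
      using the[of z0] uniq[of z0 z] by (auto simp: adjoint_operator_def)
  next
    case False
    then show ?thesis by (auto simp: adjoint_operator_def)
  qed
qed

end

end

theory Submission
  imports Defs
begin

text \<open>
  Why the theorem holds.  Over the complex numbers a densely defined symmetric operator \<open>A\<close> is
  selfadjoint as soon as \<open>A - i \<mu>\<close> and \<open>A + i \<mu>\<close> are onto for some \<open>\<mu> > 0\<close>; for selfadjoint \<open>A\<close>
  they are onto for all \<open>\<mu> > 0\<close>.  So it is enough to carry surjectivity over from \<open>S\<close> to \<open>S + T\<close>.
  Since \<open>\<parallel>(S + i \<mu>) h\<parallel>\<^sup>2 = \<parallel>S h\<parallel>\<^sup>2 + \<mu>\<^sup>2 \<parallel>h\<parallel>\<^sup>2\<close>, a relative bound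
  \<open>\<parallel>T h\<parallel>\<^sup>2 \<le> q \<parallel>S h\<parallel>\<^sup>2 + b \<parallel>h\<parallel>\<^sup>2\<close> with \<open>q < 1\<close> makes
  \<open>T (S + i \<mu>)\<^sup>-\<^sup>1\<close> a strict contraction once \<open>\<mu>\<close> is large, and \<open>S + T + i \<mu> = (1 + T (S + i \<mu>)\<^sup>-\<^sup>1) (S + i \<mu>)\<close> is onto by Banach's fixed point theorem.

  Two devices let one argument serve both scalar fields.  First, linearity of \<open>A\<close> makes
  selfadjointness depend only on the real part of the scalar product
  (\<open>selfadjoint_iff_real_part_selfadjoint\<close>), so the scalars may be taken real.  Second, the
  imaginary unit, then missing, is recovered by complexification: on pairs \<open>(h, k)\<close>, read as
  \<open>h + i k\<close>, the single map \<open>\<mu> + i A\<close> takes the place of both \<open>A + i \<mu>\<close> and \<open>A - i \<mu>\<close>, because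
  complex conjugation exchanges \<open>\<mu> + i A\<close> and \<open>\<mu> - i A\<close>.

  The two halves of the range criterion are \<open>selfadjoint_if_cshift_onto\<close> and
  \<open>cshift_onto_if_selfadjoint\<close>; the second one rests on the projection theorem, applied to the
  closed graph of a multiple of \<open>A\<close>.  The contraction argument is \<open>cshift_operator_sum_onto\<close>.
\<close>

lemma dom_operator_sum: "dom S \<subseteq> dom T \<Longrightarrow> dom (operator_sum S T) = dom S"
  by (auto simp: operator_sum_def dom_def)

lemma app_operator_sum:
  "\<lbrakk>dom S \<subseteq> dom T; h \<in> dom S\<rbrakk> \<Longrightarrow> app (operator_sum S T) h = app S h + app T h"
  by (auto simp: app_def operator_sum_def)

section \<open>Reduction to real scalars\<close>

definition real_part_ip :: "('v \<Rightarrow> 'v \<Rightarrow> 'k :: real_or_complex) \<Rightarrow> 'v \<Rightarrow> 'v \<Rightarrow> real" where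
  "real_part_ip ip x y = Re (scalar_to_complex (ip x y))"

context hilbert_space
begin

lemma real_part_hilbert_space: "hilbert_space scaleR (real_part_ip ip)"
proof unfold_locales
  fix x y z :: 'v and c :: real
  have "ip (c *\<^sub>R x) y = of_real c * ip x y"
    using ip_scale_left[of "of_real c" x y] by (simp add: scale_of_real)
  then show "real_part_ip ip (c *\<^sub>R x) y = c * real_part_ip ip x y"
    by (simp add: real_part_ip_def scalar_to_complex_mult scalar_to_complex_of_real)
  show "real_part_ip ip x y = scalar_cnj (real_part_ip ip y x)"
    unfolding real_part_ip_def scalar_cnj_real_def
    by (subst ip_commute) (simp add: scalar_to_complex_cnj)
qed (simp_all add: real_part_ip_def ip_add_left ip_self scalar_to_complex_add
       scalar_to_complex_of_real algebra_simps del: of_real_power)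

lemma subspace_imp_real_subspace: "subspace D \<Longrightarrow> module.subspace scaleR D"
  unfolding subspace_def module.subspace_def[OF real_vector.module_axioms] by (metis scale_of_real)

lemma linear_operator_imp_real_linear_operator:
  "linear_operator scaleK A \<Longrightarrow> linear_operator scaleR A"
  unfolding linear_operator_def
  by (metis scale_of_real subspace_imp_real_subspace)

text \<open>
  The real part of \<open>ip\<close> detects the defining equation of the adjoint because \<open>dom A\<close> admits all
  scalars: the difference \<open>w\<close> of the two sides at \<open>h\<close> becomes \<open>c * w\<close> at \<open>scaleK c h\<close>, and for
  \<open>c\<close> the conjugate of \<open>w\<close> this is the real number \<open>\<bar>w\<bar>\<^sup>2\<close>.
\<close>

lemma ip_eq_iff_real_part_ip_eq:
  assumes "linear_operator scaleK A"
  shows "(\<forall>h\<in>dom A. ip (app A h) k = ip h z) \<longleftrightarrow>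
         (\<forall>h\<in>dom A. real_part_ip ip (app A h) k = real_part_ip ip h z)"
proof (intro iffI ballI)
  fix h
  assume *: "\<forall>h\<in>dom A. real_part_ip ip (app A h) k = real_part_ip ip h z" and h: "h \<in> dom A"
  define w where "w = ip (app A h) k - ip h z"
  define c where "c = scalar_cnj w"
  let ?s = "scalar_to_complex :: 'k \<Rightarrow> complex"
  have diff: "?s (a - b) = ?s a - ?s b" for a b
    using scalar_to_complex_add[of "a - b" b] by simp
  have "scaleK c h \<in> dom A" "app A (scaleK c h) = scaleK c (app A h)"
    using assms h by (auto simp: linear_operator_def subspace_def)
  then have "Re (?s (c * w)) = 0"
    using *[rule_format, of "scaleK c h"]
    by (simp add: w_def real_part_ip_def ip_scale_left diff right_diff_distrib)
  moreover have "?s (c * w) = of_real ((norm w)\<^sup>2)"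
    by (metis c_def complex_norm_square mult.commute norm_scalar_to_complex
        scalar_to_complex_cnj scalar_to_complex_mult)
  ultimately show "ip (app A h) k = ip h z"
    by (simp add: w_def)
qed (simp add: real_part_ip_def)

lemma selfadjoint_iff_real_part_selfadjoint:
  assumes "linear_operator scaleK A"
  shows "selfadjoint ip A \<longleftrightarrow> selfadjoint (real_part_ip ip) A"
  unfolding selfadjoint_def adjoint_operator_def[abs_def] ip_eq_iff_real_part_ip_eq[OF assms] ..

end

section \<open>Real Hilbert spaces and the projection theorem\<close>

locale real_hilbert_space = hilbert_space scaleR ip for ip :: "'v :: banach \<Rightarrow> 'v \<Rightarrow> real"
begin

lemma ip_sym: "ip x y = ip y x"
  using ip_commute[of x y] by (simp add: scalar_cnj_real_def)

lemma ip_scaleR_right: "ip x (c *\<^sub>R y) = c * ip x y"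
  using ip_scale_left[of c y x] by (simp add: ip_sym)

lemma norm_add_squared: "(norm (x + y))\<^sup>2 = (norm x)\<^sup>2 + 2 * ip x y + (norm y)\<^sup>2"
  using ip_self[of "x + y"] ip_self[of x] ip_self[of y]
  by (simp add: ip_add_left ip_add_right ip_sym[of y x])

text \<open>
  The norm of the type already satisfies the triangle inequality; squared and expanded, it becomes
  the Cauchy-Schwarz inequality.
\<close>

lemma ip_le_norm: "ip x y \<le> norm x * norm y"
proof -
  have "(norm (x + y))\<^sup>2 \<le> (norm x + norm y)\<^sup>2"
    by (simp add: norm_triangle_ineq power_mono)
  then show ?thesis
    by (simp add: norm_add_squared power2_sum)
qed

lemma bounded_bilinear_ip: "bounded_bilinear ip"
proof
  show "\<exists>K. \<forall>x y. norm (ip x y) \<le> norm x * norm y * K"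
  proof (intro exI[of _ 1] allI)
    fix x y
    have "- ip x y = ip (- x) y"
      using ip_scale_left[of "-1" x y] by simp
    then show "norm (ip x y) \<le> norm x * norm y * 1"
      using ip_le_norm[of x y] ip_le_norm[of "- x" y] by simp
  qed
qed (use ip_scale_left in \<open>simp_all add: ip_add_left ip_add_right ip_scaleR_right\<close>)

lemmas ip_simps = bounded_bilinear.diff_left[OF bounded_bilinear_ip]
  bounded_bilinear.diff_right[OF bounded_bilinear_ip]
  bounded_bilinear.minus_left[OF bounded_bilinear_ip]
  bounded_bilinear.minus_right[OF bounded_bilinear_ip]
  bounded_bilinear.scaleR_left[OF bounded_bilinear_ip]
  ip_scaleR_right ip_add_left ip_add_right

lemma parallelogram:
  fixes x y :: 'v
  shows "(norm (x + y))\<^sup>2 + (norm (x - y))\<^sup>2 = 2 * (norm x)\<^sup>2 + 2 * (norm y)\<^sup>2"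
  using norm_add_squared[of x y] norm_add_squared[of x "- y"] by (simp add: ip_simps)

text \<open>
  The parallelogram law makes every sequence in \<open>K\<close> whose distances to \<open>x\<close> tend to the infimum a
  Cauchy sequence, so a nearest point \<open>p\<close> exists by completeness.  It is the projection, since
  otherwise moving \<open>p\<close> along some \<open>k \<in> K\<close> would bring it closer to \<open>x\<close>.
\<close>

lemma orthogonal_projection:
  assumes K: "subspace K" and "closed K"
  obtains p where "p \<in> K" "\<And>g. g \<in> K \<Longrightarrow> ip g (x - p) = 0"
proof -
  let ?f = "\<lambda>g. (norm (x - g))\<^sup>2"
  define d where "d = Inf (?f ` K)"
  have bdd: "bdd_below (?f ` K)"
    by (rule bdd_belowI[of _ 0]) auto
  have ne: "?f ` K \<noteq> {}"
    using subspace_0[OF K] by auto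
  have d_le: "d \<le> ?f g" if "g \<in> K" for g
    unfolding d_def using bdd that by (simp add: cInf_lower)
  have "\<exists>g\<in>K. ?f g < d + inverse (real (Suc n))" for n
    using cInf_lessD[OF ne, of "d + inverse (real (Suc n))"] by (auto simp: d_def)
  then obtain g where g: "\<And>n. g n \<in> K" "\<And>n. ?f (g n) < d + inverse (real (Suc n))"
    by metis
  have dist_g: "(norm (g m - g n))\<^sup>2 \<le> 2 * inverse (real (Suc m)) + 2 * inverse (real (Suc n))"
    for m n
  proof -
    have "(1/2) *\<^sub>R (g m + g n) \<in> K"
      using g(1) by (intro subspace_scale[OF K] subspace_add[OF K])
    moreover have "x - g m + (x - g n) = 2 *\<^sub>R (x - (1/2) *\<^sub>R (g m + g n))"
      by (simp add: algebra_simps scaleR_2)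
    ultimately have "4 * d \<le> (norm (x - g m + (x - g n)))\<^sup>2"
      using d_le by (simp add: power_mult_distrib)
    moreover have "norm (x - g m - (x - g n)) = norm (g m - g n)"
      by (simp add: norm_minus_commute)
    ultimately show ?thesis
      using parallelogram[of "x - g m" "x - g n"] g(2)[of m] g(2)[of n] by simp
  qed
  have "Cauchy g"
  proof (rule metric_CauchyI)
    fix e :: real assume "0 < e"
    then obtain M where M: "inverse (real (Suc M)) < e\<^sup>2 / 4"
      using reals_Archimedean[of "e\<^sup>2 / 4"] by auto
    have "dist (g m) (g n) < e" if "M \<le> m" "M \<le> n" for m n
    proof -
      have "inverse (real (Suc m)) \<le> inverse (real (Suc M))"
        "inverse (real (Suc n)) \<le> inverse (real (Suc M))"
        using that by (auto intro!: le_imp_inverse_le)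
      then have "(norm (g m - g n))\<^sup>2 < e\<^sup>2"
        using dist_g[of m n] M by linarith
      then show ?thesis
        using \<open>0 < e\<close> by (simp add: dist_norm power2_less_imp_less)
    qed
    then show "\<exists>M. \<forall>m\<ge>M. \<forall>n\<ge>M. dist (g m) (g n) < e" by blast
  qed
  then obtain p where p: "g \<longlonglongrightarrow> p"
    using Cauchy_convergent convergent_def by blast
  have "p \<in> K"
    using closed_sequentially[OF \<open>closed K\<close>] g(1) p by blast
  have "?f p \<le> d"
  proof (rule LIMSEQ_le)
    show "(\<lambda>n. ?f (g n)) \<longlonglongrightarrow> ?f p"
      by (intro tendsto_intros p)
    show "(\<lambda>n. d + inverse (real (Suc n))) \<longlonglongrightarrow> d"
      using tendsto_add[OF tendsto_const LIMSEQ_inverse_real_of_nat, of d] by simp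
    show "\<exists>N. \<forall>n\<ge>N. ?f (g n) \<le> d + inverse (real (Suc n))"
      using g(2) less_imp_le by blast
  qed
  have "ip k (x - p) = 0" if "k \<in> K" for k
  proof (rule ccontr)
    assume neq: "ip k (x - p) \<noteq> 0"
    define a where "a = ip k (x - p)"
    \<comment> \<open>the minimiser of the quadratic polynomial \<open>t \<mapsto> \<parallel>x - p - t k\<parallel>\<^sup>2\<close>\<close>
    define t where "t = a / (norm k)\<^sup>2"
    have k: "norm k \<noteq> 0"
      using neq bounded_bilinear.zero_left[OF bounded_bilinear_ip] by auto
    have in_K: "p + t *\<^sub>R k \<in> K"
      using \<open>p \<in> K\<close> that by (intro subspace_scale[OF K] subspace_add[OF K])
    have "?f p \<le> (norm (x - p + (- t) *\<^sub>R k))\<^sup>2"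
      using order_trans[OF \<open>?f p \<le> d\<close> d_le[OF in_K]] by (simp add: diff_diff_eq)
    also have "\<dots> = ?f p - 2 * t * a + t\<^sup>2 * (norm k)\<^sup>2"
      unfolding norm_add_squared by (simp add: ip_simps a_def ip_sym power_mult_distrib)
    also have "\<dots> = ?f p - a\<^sup>2 / (norm k)\<^sup>2"
      using k by (simp add: t_def power2_eq_square field_simps)
    finally show False
      using k neq by (simp add: a_def divide_le_0_iff)
  qed
  with \<open>p \<in> K\<close> that show thesis by blast
qed

text \<open>
  The graph of an operator lives in the product.  The norm of this scalar product is the norm of
  the product type, so the projection theorem applies to closed graphs.
\<close>

definition prod_ip :: "'v \<times> 'v \<Rightarrow> 'v \<times> 'v \<Rightarrow> real" where
  "prod_ip x y = ip (fst x) (fst y) + ip (snd x) (snd y)"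

lemma real_hilbert_space_prod: "real_hilbert_space prod_ip"
proof unfold_locales
  show "prod_ip x y = scalar_cnj (prod_ip y x)" for x y
    by (simp add: prod_ip_def scalar_cnj_real_def ip_sym)
  show "prod_ip x x = of_real ((norm x)\<^sup>2)" for x
    by (simp add: prod_ip_def ip_self norm_prod_def)
qed (simp_all add: prod_ip_def ip_simps algebra_simps)

section \<open>Selfadjointness through the range on the complexification\<close>

text \<open>
  Splitting \<open>A = A\<^sup>*\<close> into symmetry, \<open>A \<subseteq> A\<^sup>*\<close>, and maximality, \<open>A\<^sup>* \<subseteq> A\<close>, and expressing both
  without the definite description in the adjoint.
\<close>

lemma selfadjoint_iff:
  "selfadjoint ip A \<longleftrightarrow> densely_defined A \<and>
     (\<forall>h\<in>dom A. \<forall>k\<in>dom A. ip (app A h) k = ip h (app A k)) \<and>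
     (\<forall>k z. (\<forall>h\<in>dom A. ip (app A h) k = ip h z) \<longrightarrow> A k = Some z)"
  (is "?L \<longleftrightarrow> ?R")
proof
  assume ?L
  then have *: "A k = Some z \<longleftrightarrow> (\<forall>h\<in>dom A. ip (app A h) k = ip h z)" for k z
    using adjoint_eq_Some_iff by (metis selfadjoint_def)
  have "A k = Some (app A k)" if "k \<in> dom A" for k
    using that by (auto simp: app_def)
  then show ?R
    using \<open>?L\<close> * by (simp add: selfadjoint_def)
next
  assume R: ?R
  have "adjoint_operator ip A k = Some z \<longleftrightarrow> A k = Some z" for k z
  proof -
    have "\<forall>h\<in>dom A. ip (app A h) k = ip h z" if "A k = Some z"
    proof -
      have "k \<in> dom A" "app A k = z"
        using that by (auto simp: app_def)
      then show ?thesis using R by blast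
    qed
    then show ?thesis
      using R adjoint_eq_Some_iff[of A k z] by blast
  qed
  then have "adjoint_operator ip A = A"
    by (metis ext not_Some_eq)
  then show ?L
    using R by (simp add: selfadjoint_def)
qed

text \<open>
  The map \<open>\<mu> + i A\<close> on the complexification, with \<open>(h, k)\<close> standing for \<open>h + i k\<close>.  For \<open>\<mu> = 0\<close> it
  is \<open>i A\<close>.
\<close>

definition cshift :: "real \<Rightarrow> 'v operator \<Rightarrow> 'v \<times> 'v \<Rightarrow> 'v \<times> 'v" where
  "cshift \<mu> A x = (\<mu> *\<^sub>R fst x - app A (snd x), app A (fst x) + \<mu> *\<^sub>R snd x)"

text \<open>
  Let \<open>A\<^sup>* k = z\<close>.  Surjectivity provides \<open>a, b \<in> dom A\<close> with \<open>(\<mu> + i A) (a + i b) = \<mu> k + i z\<close>, that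
  is, \<open>\<mu> (k - a) = - A b\<close> and \<open>A\<^sup>* (k - a) = \<mu> b\<close>.  Pairing the first equation with \<open>k - a\<close> and the
  second with \<open>b\<close> gives two values of \<open>(A b | k - a)\<close>, one nonpositive and one nonnegative.  Both
  therefore vanish, so \<open>b = 0\<close> and \<open>k = a\<close>.
\<close>

lemma selfadjoint_if_cshift_onto:
  assumes dense: "densely_defined A"
    and sym: "\<And>h k. h \<in> dom A \<Longrightarrow> k \<in> dom A \<Longrightarrow> ip (app A h) k = ip h (app A k)"
    and "\<mu> > 0" and onto: "cshift \<mu> A ` (dom A \<times> dom A) = UNIV"
  shows "selfadjoint ip A"
  unfolding selfadjoint_iff
proof (intro conjI allI impI)
  fix k z
  assume adj: "\<forall>h\<in>dom A. ip (app A h) k = ip h z"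
  have "(\<mu> *\<^sub>R k, z) \<in> cshift \<mu> A ` (dom A \<times> dom A)"
    using onto by simp
  then obtain a b where ab: "a \<in> dom A" "b \<in> dom A"
    and k: "\<mu> *\<^sub>R k = \<mu> *\<^sub>R a - app A b" and z: "z = app A a + \<mu> *\<^sub>R b"
    by (force simp: cshift_def simp del: domIff)
  have "\<mu> *\<^sub>R (k - a) = - app A b"
    using k by (simp add: algebra_simps)
  then have Ab: "app A b = - (\<mu> *\<^sub>R (k - a))"
    by simp
  have "ip (app A b) (k - a) = \<mu> * (norm b)\<^sup>2"
    using adj ab sym[of b a] ip_self[of b] by (simp add: z ip_simps)
  moreover have "ip (app A b) (k - a) = - (\<mu> * (norm (k - a))\<^sup>2)"
    unfolding Ab using ip_self[of "k - a"] by (simp add: ip_simps(3,5))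
  ultimately have "\<mu> * ((norm b)\<^sup>2 + (norm (k - a))\<^sup>2) = 0"
    by (simp add: algebra_simps)
  then have "b = 0" "k = a"
    using \<open>\<mu> > 0\<close> by (auto simp: sum_power2_eq_zero_iff)
  then show "A k = Some z"
    using ab z by (auto simp: app_def)
qed (intro dense ballI sym; assumption)+

text \<open>
  The set \<open>K\<close> of all \<open>(\<mu> h, A h)\<close> is closed because selfadjointness describes it by the equations
  \<open>(A g | u) = \<mu> (g | v)\<close>.  Split a given pair into an element of \<open>K\<close> and a pair \<open>(u, v)\<close>
  orthogonal to \<open>K\<close>.  Orthogonality says \<open>A\<^sup>* v = - \<mu> u\<close>, and \<open>A\<^sup>* = A\<close>, so the second summand is
  \<open>(- A k, \<mu> k)\<close> with \<open>k = v / \<mu>\<close>.  The sum is the value of \<open>\<mu> + i A\<close> at \<open>h + i k\<close>.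
\<close>

lemma cshift_onto_if_selfadjoint:
  assumes lin: "linear_operator scaleR A" and sa: "selfadjoint ip A" and "\<mu> > 0"
  shows "cshift \<mu> A ` (dom A \<times> dom A) = UNIV"
proof -
  interpret P: real_hilbert_space prod_ip by (rule real_hilbert_space_prod)
  have sym: "ip (app A h) k = ip h (app A k)" if "h \<in> dom A" "k \<in> dom A" for h k
    using sa that unfolding selfadjoint_iff by blast
  have graph: "A k = Some z" if "\<And>h. h \<in> dom A \<Longrightarrow> ip (app A h) k = ip h z" for k z
    using sa that unfolding selfadjoint_iff by blast
  define K where "K = {x. \<forall>g\<in>dom A. ip (app A g) (fst x) = \<mu> * ip g (snd x)}"
  have K: "(\<mu> *\<^sub>R h, app A h) \<in> K" if "h \<in> dom A" for h
    using sym that by (simp add: K_def ip_simps)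
  have K_graph: "\<exists>h\<in>dom A. x = (\<mu> *\<^sub>R h, app A h)" if "x \<in> K" for x
  proof -
    define h where "h = (1 / \<mu>) *\<^sub>R fst x"
    have "A h = Some (snd x)"
      using that \<open>\<mu> > 0\<close> by (intro graph) (simp add: K_def h_def ip_simps)
    then show ?thesis
      using \<open>\<mu> > 0\<close> by (intro bexI[of _ h]) (auto simp: h_def app_def prod_eq_iff)
  qed
  have "module.subspace scaleR K"
    unfolding module.subspace_def[OF real_vector.module_axioms] K_def
    by (auto simp: ip_simps algebra_simps bounded_bilinear.zero_right[OF bounded_bilinear_ip])
  moreover have "closed K"
    unfolding K_def Collect_ball_eq
    by (intro closed_INT ballI closed_Collect_eq continuous_intros
        bounded_bilinear.continuous_on[OF bounded_bilinear_ip])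
  ultimately have proj: "\<exists>p\<in>K. \<forall>g\<in>K. prod_ip g (x - p) = 0" for x
    using P.orthogonal_projection by metis
  have "x \<in> cshift \<mu> A ` (dom A \<times> dom A)" for x
  proof -
    obtain p where p: "p \<in> K" and orth: "\<And>g. g \<in> K \<Longrightarrow> prod_ip g (x - p) = 0"
      using proj by blast
    obtain h where h: "h \<in> dom A" "p = (\<mu> *\<^sub>R h, app A h)"
      using K_graph p by blast
    define y where "y = x - p"
    have "A (snd y) = Some (- (\<mu> *\<^sub>R fst y))"
    proof (rule graph)
      fix g assume "g \<in> dom A"
      from orth[OF K[OF this]] show "ip (app A g) (snd y) = ip g (- (\<mu> *\<^sub>R fst y))"
        by (simp add: prod_ip_def y_def ip_simps(4,5) ip_scaleR_right)
    qed
    then have y: "snd y \<in> dom A" "app A (snd y) = - (\<mu> *\<^sub>R fst y)"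
      by (auto simp: app_def)
    define k where "k = (1 / \<mu>) *\<^sub>R snd y"
    have k: "k \<in> dom A" "app A k = - fst y"
      using lin y \<open>\<mu> > 0\<close> unfolding linear_operator_def k_def
      by (auto simp: subspace_scale)
    have "x = cshift \<mu> A (h, k)"
      using \<open>\<mu> > 0\<close> h(2) k(2) by (simp add: cshift_def k_def y_def prod_eq_iff)
    with h(1) k(1) show ?thesis by blast
  qed
  then show ?thesis by blast
qed

section \<open>Relatively bounded perturbations\<close>

text \<open>
  Symmetry makes the two cross terms \<open>\<plusminus> 2 \<mu> (A h | k)\<close> cancel.
\<close>

lemma norm_cshift_squared:
  assumes "ip (app A (fst x)) (snd x) = ip (fst x) (app A (snd x))"
  shows "(norm (cshift \<mu> A x))\<^sup>2 = (norm (app A (fst x)))\<^sup>2 + (norm (app A (snd x)))\<^sup>2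
           + \<mu>\<^sup>2 * (norm x)\<^sup>2"
proof -
  have norm_prod: "(norm y)\<^sup>2 = (norm (fst y))\<^sup>2 + (norm (snd y))\<^sup>2" for y :: "'v \<times> 'v"
    by (simp add: norm_prod_def)
  show ?thesis
    using norm_add_squared[of "\<mu> *\<^sub>R fst x" "- app A (snd x)"]
      norm_add_squared[of "app A (fst x)" "\<mu> *\<^sub>R snd x"] assms
    unfolding norm_prod by (simp add: cshift_def ip_simps power_mult_distrib algebra_simps)
qed

lemma cshift_diff:
  assumes "linear_operator scaleR A" "x \<in> dom A \<times> dom A" "y \<in> dom A \<times> dom A"
  shows "x - y \<in> dom A \<times> dom A" "cshift \<mu> A (x - y) = cshift \<mu> A x - cshift \<mu> A y"
proof -
  have sub: "subspace (dom A)"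
    using assms(1) by (simp add: linear_operator_def)
  then show "x - y \<in> dom A \<times> dom A"
    using assms(2,3) by (simp add: mem_Times_iff subspace_diff)
  have "app A (h - k) = app A h - app A k" if "h \<in> dom A" "k \<in> dom A" for h k
  proof -
    have "app A (h - k + k) = app A (h - k) + app A k"
      using assms(1) subspace_diff[OF sub] that by (simp only: linear_operator_def)
    then show ?thesis by simp
  qed
  then show "cshift \<mu> A (x - y) = cshift \<mu> A x - cshift \<mu> A y"
    using assms(2,3) by (simp add: cshift_def mem_Times_iff algebra_simps)
qed

text \<open>
  With a right inverse \<open>R\<close> of \<open>\<mu> + i S\<close>, the equation \<open>(\<mu> + i (S + T)) x = y\<close> is solved by
  \<open>x = R w\<close> when \<open>w = y - i T R w\<close>.  By the norm identity for \<open>\<mu> + i S\<close>, the hypothesis on \<open>T\<close>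
  says that the right-hand side is a contraction in \<open>w\<close> with constant \<open>sqrt r\<close>.
\<close>

lemma cshift_operator_sum_onto:
  assumes linS: "linear_operator scaleR S" and linT: "linear_operator scaleR T"
    and dom: "dom S \<subseteq> dom T"
    and sym: "\<And>h k. h \<in> dom S \<Longrightarrow> k \<in> dom S \<Longrightarrow> ip (app S h) k = ip h (app S k)"
    and onto: "cshift \<mu> S ` (dom S \<times> dom S) = UNIV"
    and r: "0 \<le> r" "r < 1"
    and bound: "\<And>h. h \<in> dom S \<Longrightarrow>
      (norm (app T h))\<^sup>2 \<le> r * ((norm (app S h))\<^sup>2 + \<mu>\<^sup>2 * (norm h)\<^sup>2)"
  shows "cshift \<mu> (operator_sum S T) ` (dom S \<times> dom S) = UNIV"
proof -
  let ?D = "dom S \<times> dom S"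
  define R where "R = inv_into ?D (cshift \<mu> S)"
  have R: "R w \<in> ?D" "cshift \<mu> S (R w) = w" for w
    using onto by (simp_all only: R_def inv_into_into f_inv_into_f UNIV_I)
  have "y \<in> cshift \<mu> (operator_sum S T) ` ?D" for y
  proof -
    define f where "f w = y - cshift 0 T (R w)" for w
    have "norm (f w - f w') \<le> sqrt r * norm (w - w')" for w w'
    proof -
      define u where "u = R w' - R w"
      have "R w \<in> dom T \<times> dom T" "R w' \<in> dom T \<times> dom T"
        using R(1) dom by (meson Sigma_mono subsetD)+
      then have f: "f w - f w' = cshift 0 T u"
        using cshift_diff(2)[OF linT, of "R w'" "R w" 0] by (simp only: f_def u_def) simp
      have u: "fst u \<in> dom S" "snd u \<in> dom S" and Su: "cshift \<mu> S u = w' - w"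
        using cshift_diff[OF linS R(1)[of w'] R(1)[of w]]
        by (simp_all only: u_def mem_Times_iff R(2))
      have "(norm (cshift 0 T u))\<^sup>2 = (norm (app T (fst u)))\<^sup>2 + (norm (app T (snd u)))\<^sup>2"
        by (simp add: cshift_def norm_prod_def)
      also have "\<dots> \<le> r * ((norm (app S (fst u)))\<^sup>2 + (norm (app S (snd u)))\<^sup>2 + \<mu>\<^sup>2 * (norm u)\<^sup>2)"
        using bound[OF u(1)] bound[OF u(2)] by (simp add: norm_prod_def algebra_simps)
      also have "\<dots> = r * (norm (w' - w))\<^sup>2"
        using norm_cshift_squared[of S u \<mu>, OF sym[OF u]] by (simp only: Su)
      also have "\<dots> = (sqrt r * norm (w - w'))\<^sup>2"
        using r by (simp add: power_mult_distrib norm_minus_commute)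
      finally show ?thesis
        unfolding f by (rule power2_le_imp_le) (use r in simp)
    qed
    then have "\<exists>!w. f w = w"
      using r by (intro banach_fix_type[of "sqrt r"]) (auto simp: dist_norm)
    then obtain w where "f w = w" by blast
    then have w: "y = cshift 0 T (R w) + w"
      by (simp add: f_def diff_eq_eq add.commute)
    have "cshift \<mu> (operator_sum S T) (R w) = cshift 0 T (R w) + cshift \<mu> S (R w)"
      using R(1)[of w]
      by (simp add: cshift_def mem_Times_iff app_operator_sum[OF dom] algebra_simps)
    then have "y = cshift \<mu> (operator_sum S T) (R w)"
      using w R(2)[of w] by simp
    then show ?thesis
      using R(1)[of w] by (rule image_eqI)
  qed
  then show ?thesis by blast
qed

text \<open>
  This is the Kato-Rellich theorem with a bound on squared norms.  The choice \<open>\<mu>\<^sup>2 = 2 (b + 1)\<close> and \<open>r = max q (1/2)\<close> absorbs the constant \<open>b\<close>, since then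
  \<open>b \<le> r \<mu>\<^sup>2\<close>, and keeps \<open>\<mu>\<close> positive when \<open>b = 0\<close>.
\<close>

lemma selfadjoint_operator_sum:
  assumes linS: "linear_operator scaleR S" and linT: "linear_operator scaleR T"
    and sa: "selfadjoint ip S" and dom: "dom S \<subseteq> dom T"
    and "0 \<le> q" "q < 1" "0 \<le> b"
    and bound: "\<And>h. h \<in> dom S \<Longrightarrow> (norm (app T h))\<^sup>2 \<le> q * (norm (app S h))\<^sup>2 + b * (norm h)\<^sup>2"
    and symT: "\<And>h k. h \<in> dom S \<Longrightarrow> k \<in> dom S \<Longrightarrow> ip (app T h) k = ip h (app T k)"
  shows "selfadjoint ip (operator_sum S T)"
proof -
  define \<mu> where "\<mu> = sqrt (2 * (b + 1))"
  define r where "r = max q (1/2)"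
  have \<mu>: "\<mu> > 0" "\<mu>\<^sup>2 = 2 * (b + 1)" and r: "0 \<le> r" "r < 1" "q \<le> r" "1/2 \<le> r"
    using assms(5-7) by (auto simp: \<mu>_def r_def)
  have "1/2 * \<mu>\<^sup>2 \<le> r * \<mu>\<^sup>2"
    using r(4) by (rule mult_right_mono) simp
  then have b: "b \<le> r * \<mu>\<^sup>2"
    using \<mu> by simp
  have symS: "ip (app S h) k = ip h (app S k)" if "h \<in> dom S" "k \<in> dom S" for h k
    using sa that unfolding selfadjoint_iff by blast
  note dom_sum = dom_operator_sum[OF dom] and app_sum = app_operator_sum[OF dom]
  show ?thesis
  proof (rule selfadjoint_if_cshift_onto[OF _ _ \<mu>(1)])
    show "densely_defined (operator_sum S T)"
      using sa by (simp add: selfadjoint_def densely_defined_def dom_sum)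
    show "ip (app (operator_sum S T) h) k = ip h (app (operator_sum S T) k)"
      if "h \<in> dom (operator_sum S T)" "k \<in> dom (operator_sum S T)" for h k
      using that symS[of h k] symT[of h k] by (simp add: dom_sum app_sum ip_simps(7,8))
    show "cshift \<mu> (operator_sum S T) ` (dom (operator_sum S T) \<times> dom (operator_sum S T)) = UNIV"
      unfolding dom_sum
    proof (rule cshift_operator_sum_onto[OF linS linT dom symS _ r(1,2)])
      show "cshift \<mu> S ` (dom S \<times> dom S) = UNIV"
        using linS sa \<mu>(1) by (rule cshift_onto_if_selfadjoint)
      fix h assume "h \<in> dom S"
      note bound[OF this]
      also have "q * (norm (app S h))\<^sup>2 + b * (norm h)\<^sup>2 \<le>
          r * (norm (app S h))\<^sup>2 + r * \<mu>\<^sup>2 * (norm h)\<^sup>2"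
        using r(3) b by (intro add_mono mult_right_mono) auto
      finally show "(norm (app T h))\<^sup>2 \<le> r * ((norm (app S h))\<^sup>2 + \<mu>\<^sup>2 * (norm h)\<^sup>2)"
        by (simp add: algebra_simps)
    qed auto
  qed
qed

end

section \<open>Real or complex scalars\<close>

theorem corollary3p9:
  fixes scaleK :: "'k :: real_or_complex \<Rightarrow> 'v :: banach \<Rightarrow> 'v"
    and ip :: "'v \<Rightarrow> 'v \<Rightarrow> 'k"
    and S T :: "'v operator"
    and q :: real
  assumes "hilbert_space scaleK ip"
    and "linear_operator scaleK S"
    and "linear_operator scaleK T"
    and "selfadjoint ip S"
    and "dom S \<subseteq> dom T"
    and "0 \<le> q" and "q < 1"
    and "\<And>h. h \<in> dom S \<Longrightarrow> (norm (app T h))\<^sup>2 \<le> q * (norm (app S h))\<^sup>2 + (norm h)\<^sup>2"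
    and "\<And>h k. h \<in> dom S \<Longrightarrow> k \<in> dom S \<Longrightarrow> ip (app T h) k = ip h (app T k)"
  shows "selfadjoint ip (operator_sum S T)"
proof -
  interpret hilbert_space scaleK ip by fact
  interpret R: real_hilbert_space "real_part_ip ip"
    unfolding real_hilbert_space_def by (rule real_part_hilbert_space)
  note dom_sum = dom_operator_sum[OF assms(5)] and app_sum = app_operator_sum[OF assms(5)]
  have lin_sum: "linear_operator scaleK (operator_sum S T)"
    using assms(2,3,5)
    by (simp add: linear_operator_def dom_sum app_sum subspace_def subset_iff scale_right_distrib)
  have "selfadjoint (real_part_ip ip) (operator_sum S T)"
  proof (rule R.selfadjoint_operator_sum[OF _ _ _ assms(5-7) zero_le_one])
    show "linear_operator scaleR S" "linear_operator scaleR T"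
      using assms(2,3) by (simp_all only: linear_operator_imp_real_linear_operator)
    show "selfadjoint (real_part_ip ip) S"
      using assms(4) selfadjoint_iff_real_part_selfadjoint[OF assms(2)] by simp
    show "(norm (app T h))\<^sup>2 \<le> q * (norm (app S h))\<^sup>2 + 1 * (norm h)\<^sup>2" if "h \<in> dom S" for h
      using assms(8)[OF that] by simp
    show "real_part_ip ip (app T h) k = real_part_ip ip h (app T k)"
      if "h \<in> dom S" "k \<in> dom S" for h k
      using assms(9)[OF that] by (simp only: real_part_ip_def)
  qed
  then show ?thesis
    using selfadjoint_iff_real_part_selfadjoint[OF lin_sum] by simp
qed

end
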